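(* For ELPs the following hold, where "$A$ is strictly stronger than $B$" means that every pair of ELPs satisfying $A$ satisfies $B$, and there is a pair of ELPs satisfying $B$ but not $A$: (1) strong equivalence is strictly stronger than uniform CWV-equivalence; (2) uniform CWV-equivalence is strictly stronger than uniform WV-equivalence; (3) uniform CWV-equivalence is strictly stronger than (ordinary) CWV-equivalence; (4) uniform WV-equivalence is strictly stronger than (ordinary) WV-equivalence.
   Context: Logic programs, GL-reduct and answer sets $AS(\cdot)$ are as usual for disjunctive programs with nested default negation $\neg$. An ELP is a triple $(\mathcal{A},\mathcal{E},\mathcal{R})$: $\mathcal{A}$ atoms, $\mathcal{E}$ a set of epistemic literals $\mathbf{not}\,\ell$ ($\ell$ a literal), $\mathcal{R}$ a finite set of rules $a_1\vee\cdots\vee a_k\leftarrow\ell_1,\dots,\ell_m,\xi_1,\dots,\xi_j,\neg\xi_{j+1},\dots,\neg\xi_n$ with $\xi_i\in\mathcal{E}$. Union is componentwise; a set of facts $D\subseteq\mathcal{A}$ is the ELP $(\mathcal{A},\emptyset,\{a\leftarrow\mid a\in D\})$. When comparing two ELPs they are assumed to have the same $\mathcal{A}$ and $\mathcal{E}$. For a guess $\Phi\subseteq\mathcal{E}$, the epistemic reduct $\Pi^\Phi$ replaces each $\mathbf{not}\,\ell\in\Phi$ by $\top$ and every remaining $\mathbf{not}$ by $\neg$. $\mathcal{I}$ is $\Phi$-compatible w.r.t. $\mathcal{E}$ iff $\mathcal{I}\neq\emptyset$, each $\mathbf{not}\,\ell\in\Phi$ has some $I\in\mathcal{I}$ with $I\not\models\ell$,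 and each $\mathbf{not}\,\ell\in\mathcal{E}\setminus\Phi$ has $I\models\ell$ for all $I\in\mathcal{I}$. A CWV of $\Pi$ is $\mathcal{M}=AS(\Pi^\Phi)$ that is $\Phi$-compatible for some $\Phi$; a WV is a CWV whose guess is subset-maximal among guesses yielding CWVs. Two ELPs are CWV-equivalent (WV-equivalent) iff they have the same CWVs (WVs); uniformly CWV-(WV-)equivalent iff $\Pi_1\cup D$ and $\Pi_2\cup D$ are CWV-(WV-)equivalent for every set of facts $D\subseteq\mathcal{A}$; strongly equivalent iff for every ELP $\Pi$, $\Pi_1\cup\Pi$ and $\Pi_2\cup\Pi$ are CWV-equivalent (equivalently, WV-equivalent). *)

theory Defs
  imports Main
begin

(* Body elements of logic programs: atoms, \<top>, and default negation nested to any depth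
   (the epistemic reduct can produce up to three nested negations). *)
datatype 'a nlit = Top | Atom 'a | Neg "'a nlit"

fun nsat :: "'a set \<Rightarrow> 'a nlit \<Rightarrow> bool" where
  "nsat I Top \<longleftrightarrow> True"
| "nsat I (Atom a) \<longleftrightarrow> a \<in> I"
| "nsat I (Neg b) \<longleftrightarrow> \<not> nsat I b"

record 'a lp_rule =
  lp_head :: "'a set"
  lp_body :: "'a nlit set"

record 'a lp =
  lp_atoms :: "'a set"
  lp_rules :: "'a lp_rule set"

definition rule_sat :: "'a set \<Rightarrow> 'a lp_rule \<Rightarrow> bool" where
  "rule_sat I r \<longleftrightarrow> ((\<forall>b \<in> lp_body r. nsat I b) \<longrightarrow> (\<exists>a \<in> lp_head r. a \<in> I))"

definition lp_models :: "'a lp \<Rightarrow> 'a set set" where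
  "lp_models P = {I. I \<subseteq> lp_atoms P \<and> (\<forall>r \<in> lp_rules P. rule_sat I r)}"

definition positive_body :: "'a lp_rule \<Rightarrow> 'a nlit set" where
  "positive_body r = {Atom a | a. Atom a \<in> lp_body r}"

definition GL_reduct :: "'a lp \<Rightarrow> 'a set \<Rightarrow> 'a lp" where
  "GL_reduct P I =
    \<lparr>lp_atoms = lp_atoms P,
     lp_rules = {\<lparr>lp_head = lp_head r, lp_body = positive_body r\<rparr> | r.
       r \<in> lp_rules P \<and> (\<forall>b. Neg b \<in> lp_body r \<longrightarrow> nsat I (Neg b))}\<rparr>"

definition answer_sets :: "'a lp \<Rightarrow> 'a set set" where
  "answer_sets P =
    {M. M \<in> lp_models P \<and> \<not> (\<exists>M'. M' \<subset> M \<and> M' \<in> lp_models (GL_reduct P M))}"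


datatype 'a literal = PosLit 'a | NegLit 'a

fun lit_atom :: "'a literal \<Rightarrow> 'a" where
  "lit_atom (PosLit a) = a"
| "lit_atom (NegLit a) = a"

fun nlit_of :: "'a literal \<Rightarrow> 'a nlit" where
  "nlit_of (PosLit a) = Atom a"
| "nlit_of (NegLit a) = Neg (Atom a)"

fun lit_sat :: "'a set \<Rightarrow> 'a literal \<Rightarrow> bool" where
  "lit_sat I (PosLit a) \<longleftrightarrow> a \<in> I"
| "lit_sat I (NegLit a) \<longleftrightarrow> a \<notin> I"

datatype 'a epistemic_literal = ENot "'a literal"

fun elit_lit :: "'a epistemic_literal \<Rightarrow> 'a literal" where
  "elit_lit (ENot l) = l"

(* \<open>body_epos\<close> holds the \<xi> occurring unnegated in the body, \<open>body_eneg\<close> the \<xi> occurring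
   as \<not>\<xi>. An empty head is a constraint. *)
record 'a elp_rule =
  head :: "'a set"
  body_lits :: "'a literal set"
  body_epos :: "'a epistemic_literal set"
  body_eneg :: "'a epistemic_literal set"

record 'a elp =
  atoms :: "'a set"
  elits :: "'a epistemic_literal set"
  rules :: "'a elp_rule set"

definition elp_rule_over :: "'a set \<Rightarrow> 'a epistemic_literal set \<Rightarrow> 'a elp_rule \<Rightarrow> bool" where
  "elp_rule_over A E r \<longleftrightarrow>
    finite (head r) \<and> head r \<subseteq> A \<and>
    finite (body_lits r) \<and> lit_atom ` body_lits r \<subseteq> A \<and>
    finite (body_epos r) \<and> body_epos r \<subseteq> E \<and>
    finite (body_eneg r) \<and> body_eneg r \<subseteq> E"

definition is_elp :: "'a elp \<Rightarrow> bool" where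
  "is_elp P \<longleftrightarrow>
    (\<forall>\<xi> \<in> elits P. lit_atom (elit_lit \<xi>) \<in> atoms P) \<and>
    finite (rules P) \<and> (\<forall>r \<in> rules P. elp_rule_over (atoms P) (elits P) r)"

definition elp_union :: "'a elp \<Rightarrow> 'a elp \<Rightarrow> 'a elp" where
  "elp_union P Q =
    \<lparr>atoms = atoms P \<union> atoms Q, elits = elits P \<union> elits Q, rules = rules P \<union> rules Q\<rparr>"

definition facts :: "'a set \<Rightarrow> 'a set \<Rightarrow> 'a elp" where
  "facts A D =
    \<lparr>atoms = A, elits = {},
     rules = {\<lparr>head = {a}, body_lits = {}, body_epos = {}, body_eneg = {}\<rparr> | a. a \<in> D}\<rparr>"

definition reduct_elit :: "'a epistemic_literal set \<Rightarrow> 'a epistemic_literal \<Rightarrow> 'a nlit" where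
  "reduct_elit \<Phi> \<xi> = (if \<xi> \<in> \<Phi> then Top else Neg (nlit_of (elit_lit \<xi>)))"

definition reduct_rule :: "'a epistemic_literal set \<Rightarrow> 'a elp_rule \<Rightarrow> 'a lp_rule" where
  "reduct_rule \<Phi> r =
    \<lparr>lp_head = head r,
     lp_body = nlit_of ` body_lits r \<union> reduct_elit \<Phi> ` body_epos r
       \<union> (\<lambda>\<xi>. Neg (reduct_elit \<Phi> \<xi>)) ` body_eneg r\<rparr>"

definition epistemic_reduct :: "'a elp \<Rightarrow> 'a epistemic_literal set \<Rightarrow> 'a lp" where
  "epistemic_reduct P \<Phi> = \<lparr>lp_atoms = atoms P, lp_rules = reduct_rule \<Phi> ` rules P\<rparr>"

definition compatible ::
  "'a epistemic_literal set \<Rightarrow> 'a epistemic_literal set \<Rightarrow> 'a set set \<Rightarrow> bool" where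
  "compatible \<Phi> E \<I> \<longleftrightarrow>
    \<I> \<noteq> {} \<and>
    (\<forall>\<xi> \<in> \<Phi>. \<exists>I \<in> \<I>. \<not> lit_sat I (elit_lit \<xi>)) \<and>
    (\<forall>\<xi> \<in> E - \<Phi>. \<forall>I \<in> \<I>. lit_sat I (elit_lit \<xi>))"

definition cwv_guess :: "'a elp \<Rightarrow> 'a epistemic_literal set \<Rightarrow> 'a set set \<Rightarrow> bool" where
  "cwv_guess P \<Phi> \<M> \<longleftrightarrow>
    \<Phi> \<subseteq> elits P \<and> \<M> = answer_sets (epistemic_reduct P \<Phi>) \<and> compatible \<Phi> (elits P) \<M>"

definition CWV :: "'a elp \<Rightarrow> 'a set set set" where
  "CWV P = {\<M>. \<exists>\<Phi>. cwv_guess P \<Phi> \<M>}"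

definition WV :: "'a elp \<Rightarrow> 'a set set set" where
  "WV P = {\<M>. \<exists>\<Phi>. cwv_guess P \<Phi> \<M> \<and> \<not> (\<exists>\<Phi>' \<M>'. cwv_guess P \<Phi>' \<M>' \<and> \<Phi> \<subset> \<Phi>')}"


definition CWV_equivalent :: "'a elp \<Rightarrow> 'a elp \<Rightarrow> bool" where
  "CWV_equivalent P Q \<longleftrightarrow> CWV P = CWV Q"

definition WV_equivalent :: "'a elp \<Rightarrow> 'a elp \<Rightarrow> bool" where
  "WV_equivalent P Q \<longleftrightarrow> WV P = WV Q"

(* The equivalence notions are only used for P and Q with the same atoms
   (see \<open>strictly_stronger\<close>), so bounding D by the atoms of P is no loss. *)
definition uniformly_CWV_equivalent :: "'a elp \<Rightarrow> 'a elp \<Rightarrow> bool" where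
  "uniformly_CWV_equivalent P Q \<longleftrightarrow>
    (\<forall>D. D \<subseteq> atoms P \<longrightarrow>
      CWV_equivalent (elp_union P (facts (atoms P) D)) (elp_union Q (facts (atoms P) D)))"

definition uniformly_WV_equivalent :: "'a elp \<Rightarrow> 'a elp \<Rightarrow> bool" where
  "uniformly_WV_equivalent P Q \<longleftrightarrow>
    (\<forall>D. D \<subseteq> atoms P \<longrightarrow>
      WV_equivalent (elp_union P (facts (atoms P) D)) (elp_union Q (facts (atoms P) D)))"

(* The context program R may bring in atoms and epistemic literals of its own. *)
definition strongly_equivalent :: "'a elp \<Rightarrow> 'a elp \<Rightarrow> bool" where
  "strongly_equivalent P Q \<longleftrightarrow>
    (\<forall>R. is_elp R \<longrightarrow> CWV_equivalent (elp_union P R) (elp_union Q R))"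

definition elp_pair :: "'a elp \<Rightarrow> 'a elp \<Rightarrow> bool" where
  "elp_pair P Q \<longleftrightarrow> is_elp P \<and> is_elp Q \<and> atoms P = atoms Q \<and> elits P = elits Q"

definition strictly_stronger ::
  "('a elp \<Rightarrow> 'a elp \<Rightarrow> bool) \<Rightarrow> ('a elp \<Rightarrow> 'a elp \<Rightarrow> bool) \<Rightarrow> bool" where
  "strictly_stronger S T \<longleftrightarrow>
    (\<forall>P Q. elp_pair P Q \<and> S P Q \<longrightarrow> T P Q) \<and>
    (\<exists>P Q. elp_pair P Q \<and> T P Q \<and> \<not> S P Q)"

end

theory Submission
  imports Defs
begin

text \<open>
  A CWV determines its guess, so the CWVs determine the WVs. Hence uniform CWV-equivalence implies
  uniform WV-equivalence, and uniform equivalence implies ordinary equivalence by adding no facts.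

  That strong equivalence implies uniform CWV-equivalence is not immediate, because the set of
  facts \<open>D\<close> may be infinite whereas a context program is finite. But the rules of the two programs
  mention only a finite set \<open>V\<close> of atoms, and the facts in \<open>D - V\<close> are merely added to every
  answer set in every CWV. Thus the finite context \<open>D \<inter> V\<close> suffices.

  Strictness is witnessed by
  (1) \<open>{a \<or> b}\<close> and \<open>{a \<leftarrow> \<not>b, b \<leftarrow> \<not>a}\<close>, separated by the context \<open>{a \<leftarrow> b, b \<leftarrow> a}\<close>;
  (2) \<open>{a \<or> b \<leftarrow> not \<not>a, not \<not>b}\<close> and \<open>{a \<or> b}\<close>, where only the former has the CWV \<open>{\<emptyset>}\<close>, which is
  not a WV;
  (3), (4) the empty program and \<open>{\<leftarrow> a}\<close>, separated by the fact \<open>a\<close>.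
\<close>

section \<open>Answer sets as equilibrium models\<close>

text \<open>
  The logic of here-and-there, with \<open>X\<close> as the world \<open>here\<close> and \<open>M\<close> as the world \<open>there\<close>: a pair
  \<open>(X, M)\<close> satisfies a program iff \<open>X\<close> satisfies its GL-reduct with respect to \<open>M\<close>.
\<close>

fun ht_nsat :: "'a set \<Rightarrow> 'a set \<Rightarrow> 'a nlit \<Rightarrow> bool" where
  "ht_nsat X M Top \<longleftrightarrow> True"
| "ht_nsat X M (Atom a) \<longleftrightarrow> a \<in> X"
| "ht_nsat X M (Neg b) \<longleftrightarrow> \<not> nsat M b"

definition ht_rule_sat :: "'a set \<Rightarrow> 'a set \<Rightarrow> 'a lp_rule \<Rightarrow> bool" where
  "ht_rule_sat X M r \<longleftrightarrow> (\<forall>b \<in> lp_body r. ht_nsat X M b) \<longrightarrow> (\<exists>a \<in> lp_head r. a \<in> X)"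

definition ht_model :: "'a lp \<Rightarrow> 'a set \<Rightarrow> 'a set \<Rightarrow> bool" where
  "ht_model P X M \<longleftrightarrow> (\<forall>r \<in> lp_rules P. ht_rule_sat X M r)"

lemma ht_nsat_total [simp]: "ht_nsat M M b \<longleftrightarrow> nsat M b"
  by (cases b) auto

lemma ht_nsat_persistent: "X \<subseteq> M \<Longrightarrow> ht_nsat X M b \<Longrightarrow> nsat M b"
  by (cases b) auto

lemma lp_models_iff_ht_model: "M \<in> lp_models P \<longleftrightarrow> M \<subseteq> lp_atoms P \<and> ht_model P M M"
  by (simp add: lp_models_def ht_model_def ht_rule_sat_def rule_sat_def)

lemma ht_body_sat_iff:
  "(\<forall>b \<in> lp_body r. ht_nsat X M b) \<longleftrightarrow>
    (\<forall>b \<in> positive_body r. nsat X b) \<and> (\<forall>b. Neg b \<in> lp_body r \<longrightarrow> nsat M (Neg b))"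
proof -
  have "(\<forall>b \<in> B. Q b) \<longleftrightarrow>
      (Top \<in> B \<longrightarrow> Q Top) \<and> (\<forall>a. Atom a \<in> B \<longrightarrow> Q (Atom a)) \<and> (\<forall>b. Neg b \<in> B \<longrightarrow> Q (Neg b))"
    for B and Q :: "'a nlit \<Rightarrow> bool"
    by (metis nlit.exhaust)
  from this[of "lp_body r" "ht_nsat X M"] show ?thesis
    by (auto simp: positive_body_def)
qed

lemma lp_models_GL_reduct_iff_ht_model:
  "X \<in> lp_models (GL_reduct P M) \<longleftrightarrow> X \<subseteq> lp_atoms P \<and> ht_model P X M"
proof -
  have "ht_rule_sat X M r \<longleftrightarrow>
      ((\<forall>b. Neg b \<in> lp_body r \<longrightarrow> nsat M (Neg b)) \<longrightarrow>
        rule_sat X \<lparr>lp_head = lp_head r, lp_body = positive_body r\<rparr>)" for r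
    unfolding ht_rule_sat_def ht_body_sat_iff rule_sat_def lp_rule.simps by blast
  then show ?thesis
    unfolding lp_models_def GL_reduct_def ht_model_def lp.simps by blast
qed

lemma answer_sets_iff_equilibrium:
  "M \<in> answer_sets P \<longleftrightarrow>
    M \<subseteq> lp_atoms P \<and> ht_model P M M \<and> (\<forall>X. X \<subset> M \<longrightarrow> \<not> ht_model P X M)"
  unfolding answer_sets_def mem_Collect_eq lp_models_GL_reduct_iff_ht_model
  unfolding lp_models_iff_ht_model
  by (meson psubset_imp_subset subset_trans)

lemma answer_set_subset_heads:
  assumes "M \<in> answer_sets P"
  shows "M \<subseteq> \<Union> (lp_head ` lp_rules P)"
proof -
  define X where "X = M \<inter> \<Union> (lp_head ` lp_rules P)"
  have "ht_rule_sat X M r" if rule: "r \<in> lp_rules P" for r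
    unfolding ht_rule_sat_def
  proof
    assume "\<forall>b \<in> lp_body r. ht_nsat X M b"
    then have "\<forall>b \<in> lp_body r. nsat M b"
      using ht_nsat_persistent[of X M] by (auto simp: X_def)
    then have "\<exists>a \<in> lp_head r. a \<in> M"
      using assms rule by (simp add: answer_sets_iff_equilibrium ht_model_def ht_rule_sat_def)
    then show "\<exists>a \<in> lp_head r. a \<in> X"
      using rule by (auto simp: X_def)
  qed
  then have "\<not> X \<subset> M"
    using assms unfolding answer_sets_iff_equilibrium ht_model_def by blast
  then show ?thesis
    unfolding X_def by blast
qed

section \<open>Adding facts to logic programs\<close>

definition lp_add_facts :: "'a lp \<Rightarrow> 'a set \<Rightarrow> 'a lp" where
  "lp_add_facts P D =
    \<lparr>lp_atoms = lp_atoms P, lp_rules = lp_rules P \<union> {\<lparr>lp_head = {a}, lp_body = {}\<rparr> | a. a \<in> D}\<rparr>"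

definition lp_occurring_atoms :: "'a lp \<Rightarrow> 'a set" where
  "lp_occurring_atoms P = (\<Union>r \<in> lp_rules P. lp_head r \<union> \<Union> (set_nlit ` lp_body r))"

lemma lp_atoms_lp_add_facts [simp]: "lp_atoms (lp_add_facts P D) = lp_atoms P"
  by (simp add: lp_add_facts_def)

lemma ht_model_lp_add_facts [simp]:
  "ht_model (lp_add_facts P D) X M \<longleftrightarrow> D \<subseteq> X \<and> ht_model P X M"
proof -
  have "ht_rule_sat X M \<lparr>lp_head = {a}, lp_body = {}\<rparr> \<longleftrightarrow> a \<in> X" for a
    by (simp add: ht_rule_sat_def)
  then show ?thesis
    unfolding lp_add_facts_def ht_model_def lp.simps by blast
qed

lemma answer_sets_lp_add_facts_if_redundant_rules:
  assumes "D \<subseteq> lp_atoms P"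
    and "\<And>X M. D \<subseteq> X \<Longrightarrow> X \<subseteq> M \<Longrightarrow> ht_model P X M"
  shows "answer_sets (lp_add_facts P D) = {D}"
proof (intro equalityI subsetI)
  fix M
  assume "M \<in> answer_sets (lp_add_facts P D)"
  then have "D \<subseteq> M" "\<not> D \<subset> M"
    using assms(2)[of D M] by (auto simp: answer_sets_iff_equilibrium)
  then show "M \<in> {D}"
    by blast
qed (use assms in \<open>auto simp: answer_sets_iff_equilibrium\<close>)

lemma nsat_Un_fresh: "E \<inter> set_nlit b = {} \<Longrightarrow> nsat (E \<union> I) b \<longleftrightarrow> nsat I b"
  by (induction b) auto

lemma ht_nsat_Un_fresh:
  "E \<inter> set_nlit b = {} \<Longrightarrow> ht_nsat (E \<union> X) (E \<union> M) b \<longleftrightarrow> ht_nsat X M b"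
  by (cases b) (auto simp: nsat_Un_fresh)

lemma ht_model_Un_fresh:
  assumes "E \<inter> lp_occurring_atoms P = {}"
  shows "ht_model P (E \<union> X) (E \<union> M) \<longleftrightarrow> ht_model P X M"
  unfolding ht_model_def
proof (intro ball_cong refl)
  fix r
  assume rule: "r \<in> lp_rules P"
  have "E \<inter> set_nlit b = {}" if "b \<in> lp_body r" for b
    using assms rule that by (auto simp: lp_occurring_atoms_def)
  then have "(\<forall>b \<in> lp_body r. ht_nsat (E \<union> X) (E \<union> M) b) \<longleftrightarrow> (\<forall>b \<in> lp_body r. ht_nsat X M b)"
    by (simp add: ht_nsat_Un_fresh)
  moreover have "(\<exists>a \<in> lp_head r. a \<in> E \<union> X) \<longleftrightarrow> (\<exists>a \<in> lp_head r. a \<in> X)"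
    using assms rule by (auto simp: lp_occurring_atoms_def)
  ultimately show "ht_rule_sat (E \<union> X) (E \<union> M) r \<longleftrightarrow> ht_rule_sat X M r"
    by (simp add: ht_rule_sat_def)
qed

lemma Un_fresh_mem_answer_sets_iff:
  assumes fresh: "E \<inter> lp_occurring_atoms P = {}" and E_subset: "E \<subseteq> lp_atoms P"
    and disj: "E \<inter> I = {}"
  shows "E \<union> I \<in> answer_sets (lp_add_facts P E) \<longleftrightarrow> I \<in> answer_sets P"
proof -
  have "(\<exists>X \<subset> E \<union> I. E \<subseteq> X \<and> ht_model P X (E \<union> I)) \<longleftrightarrow> (\<exists>Y \<subset> I. ht_model P Y I)"
  proof
    assume "\<exists>X \<subset> E \<union> I. E \<subseteq> X \<and> ht_model P X (E \<union> I)"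
    then obtain X where between: "X \<subset> E \<union> I" "E \<subseteq> X" "ht_model P X (E \<union> I)"
      by blast
    then have "ht_model P (X - E) I"
      using ht_model_Un_fresh[OF fresh, of "X - E" I] by (simp add: Un_absorb1)
    moreover have "X - E \<subset> I"
      using between by blast
    ultimately show "\<exists>Y \<subset> I. ht_model P Y I"
      by blast
  next
    assume "\<exists>Y \<subset> I. ht_model P Y I"
    then obtain Y where smaller: "Y \<subset> I" "ht_model P Y I"
      by blast
    then have "E \<union> Y \<subset> E \<union> I"
      using disj by blast
    then show "\<exists>X \<subset> E \<union> I. E \<subseteq> X \<and> ht_model P X (E \<union> I)"
      using smaller ht_model_Un_fresh[OF fresh] by blast
  qed
  then have "(\<forall>X. X \<subset> E \<union> I \<longrightarrow> \<not> (E \<subseteq> X \<and> ht_model P X (E \<union> I))) \<longleftrightarrow>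
      (\<forall>Y. Y \<subset> I \<longrightarrow> \<not> ht_model P Y I)"
    by blast
  then show ?thesis
    using E_subset by (simp add: answer_sets_iff_equilibrium ht_model_Un_fresh[OF fresh])
qed

lemma answer_sets_lp_add_fresh_facts:
  assumes fresh: "E \<inter> lp_occurring_atoms P = {}" and "E \<subseteq> lp_atoms P"
  shows "answer_sets (lp_add_facts P E) = (\<union>) E ` answer_sets P"
proof (intro equalityI subsetI)
  fix M
  assume answer_set: "M \<in> answer_sets (lp_add_facts P E)"
  then have "M = E \<union> (M - E)"
    unfolding answer_sets_iff_equilibrium ht_model_lp_add_facts by blast
  moreover from this have "M - E \<in> answer_sets P"
    using answer_set Un_fresh_mem_answer_sets_iff[OF assms, of "M - E"] by simp
  ultimately show "M \<in> (\<union>) E ` answer_sets P"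
    by (rule image_eqI)
next
  fix M
  assume "M \<in> (\<union>) E ` answer_sets P"
  then obtain I where image: "M = E \<union> I" "I \<in> answer_sets P"
    by blast
  moreover have "E \<inter> I = {}"
    using answer_set_subset_heads[OF image(2)] fresh by (auto simp: lp_occurring_atoms_def)
  ultimately show "M \<in> answer_sets (lp_add_facts P E)"
    using Un_fresh_mem_answer_sets_iff[OF assms] by blast
qed

section \<open>Epistemic reducts\<close>

definition rule_atoms :: "'a elp_rule \<Rightarrow> 'a set" where
  "rule_atoms r = head r \<union> lit_atom ` body_lits r \<union>
    (\<lambda>\<xi>. lit_atom (elit_lit \<xi>)) ` (body_epos r \<union> body_eneg r)"

definition occurring_atoms :: "'a elp \<Rightarrow> 'a set" where
  "occurring_atoms P = \<Union> (rule_atoms ` rules P)"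

lemma finite_occurring_atoms: "is_elp P \<Longrightarrow> finite (occurring_atoms P)"
  by (auto simp: occurring_atoms_def rule_atoms_def is_elp_def elp_rule_over_def)

lemma set_nlit_nlit_of [simp]: "set_nlit (nlit_of l) = {lit_atom l}"
  by (cases l) auto

lemma nsat_nlit_of [simp]: "nsat I (nlit_of l) \<longleftrightarrow> lit_sat I l"
  by (cases l) auto

lemma lp_atoms_epistemic_reduct [simp]: "lp_atoms (epistemic_reduct P \<Phi>) = atoms P"
  by (simp add: epistemic_reduct_def)

lemma lp_occurring_atoms_epistemic_reduct:
  "lp_occurring_atoms (epistemic_reduct P \<Phi>) \<subseteq> occurring_atoms P"
proof -
  have "set_nlit (reduct_elit \<Phi> \<xi>) \<subseteq> {lit_atom (elit_lit \<xi>)}" for \<xi>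
    by (simp add: reduct_elit_def)
  then have "lp_head (reduct_rule \<Phi> r) \<union> \<Union> (set_nlit ` lp_body (reduct_rule \<Phi> r)) \<subseteq>
      rule_atoms r" for r
    by (fastforce simp: reduct_rule_def rule_atoms_def)
  then show ?thesis
    unfolding lp_occurring_atoms_def occurring_atoms_def epistemic_reduct_def lp.simps by blast
qed

lemma epistemic_reduct_cong:
  assumes "\<And>\<xi>. lit_atom (elit_lit \<xi>) \<in> occurring_atoms P \<Longrightarrow> \<xi> \<in> \<Phi> \<longleftrightarrow> \<xi> \<in> \<Psi>"
  shows "epistemic_reduct P \<Phi> = epistemic_reduct P \<Psi>"
proof -
  have "reduct_rule \<Phi> r = reduct_rule \<Psi> r" if rule: "r \<in> rules P" for r
  proof -
    have "reduct_elit \<Phi> \<xi> = reduct_elit \<Psi> \<xi>" if "\<xi> \<in> body_epos r \<union> body_eneg r" for \<xi>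
    proof -
      have "lit_atom (elit_lit \<xi>) \<in> occurring_atoms P"
        using rule that by (auto simp: occurring_atoms_def rule_atoms_def)
      then show ?thesis
        using assms by (simp add: reduct_elit_def)
    qed
    then show ?thesis
      by (simp add: reduct_rule_def)
  qed
  then show ?thesis
    by (simp add: epistemic_reduct_def)
qed

lemma atoms_elp_union [simp]: "atoms (elp_union P Q) = atoms P \<union> atoms Q"
  and elits_elp_union [simp]: "elits (elp_union P Q) = elits P \<union> elits Q"
  by (simp_all add: elp_union_def)

abbreviation add_facts :: "'a elp \<Rightarrow> 'a set \<Rightarrow> 'a elp" where
  "add_facts P D \<equiv> elp_union P (facts (atoms P) D)"

lemma atoms_facts [simp]: "atoms (facts A D) = A"
  and elits_facts [simp]: "elits (facts A D) = {}"
  by (simp_all add: facts_def)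

lemma add_facts_empty [simp]: "add_facts P {} = P"
  by (simp add: elp_union_def facts_def)

lemma add_facts_add_facts: "add_facts (add_facts P D) E = add_facts P (D \<union> E)"
  by (auto simp: elp_union_def facts_def)

lemma occurring_atoms_add_facts: "occurring_atoms (add_facts P D) = occurring_atoms P \<union> D"
  by (auto simp: occurring_atoms_def rule_atoms_def elp_union_def facts_def)

lemma is_elp_facts: "finite D \<Longrightarrow> D \<subseteq> A \<Longrightarrow> is_elp (facts A D)"
  by (auto simp: is_elp_def facts_def elp_rule_over_def)

lemma epistemic_reduct_add_facts:
  "epistemic_reduct (add_facts P D) \<Phi> = lp_add_facts (epistemic_reduct P \<Phi>) D"
  by (simp add: epistemic_reduct_def lp_add_facts_def elp_union_def facts_def reduct_rule_def
      Setcompr_eq_image image_Un image_image)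

lemma answer_sets_epistemic_reduct_add_fresh_facts:
  assumes "E \<inter> occurring_atoms P = {}" "E \<subseteq> atoms P"
  shows "answer_sets (epistemic_reduct (add_facts P E) \<Phi>) =
    (\<union>) E ` answer_sets (epistemic_reduct P \<Phi>)"
  unfolding epistemic_reduct_add_facts
proof (rule answer_sets_lp_add_fresh_facts)
  show "E \<inter> lp_occurring_atoms (epistemic_reduct P \<Phi>) = {}"
    using assms(1) lp_occurring_atoms_epistemic_reduct[of P \<Phi>] by blast
qed (simp add: assms(2))

lemma ht_model_epistemic_reduct_elp_union:
  "ht_model (epistemic_reduct (elp_union P Q) \<Phi>) X M \<longleftrightarrow>
    ht_model (epistemic_reduct P \<Phi>) X M \<and> ht_model (epistemic_reduct Q \<Phi>) X M"
  by (simp add: ht_model_def epistemic_reduct_def elp_union_def ball_Un)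

section \<open>World views and their guesses\<close>

definition induced_guess :: "'a epistemic_literal set \<Rightarrow> 'a set set \<Rightarrow> 'a epistemic_literal set" where
  "induced_guess E \<M> = {\<xi> \<in> E. \<exists>I \<in> \<M>. \<not> lit_sat I (elit_lit \<xi>)}"

lemma cwv_guess_iff:
  "cwv_guess P \<Phi> \<M> \<longleftrightarrow>
    \<Phi> = induced_guess (elits P) \<M> \<and> \<M> \<noteq> {} \<and> \<M> = answer_sets (epistemic_reduct P \<Phi>)"
proof -
  have "\<Phi> \<subseteq> elits P \<and> compatible \<Phi> (elits P) \<M> \<longleftrightarrow>
      \<Phi> = induced_guess (elits P) \<M> \<and> \<M> \<noteq> {}"
    by (auto simp: compatible_def induced_guess_def)
  then show ?thesis
    unfolding cwv_guess_def by blast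
qed

lemma CWV_iff:
  "\<M> \<in> CWV P \<longleftrightarrow>
    \<M> \<noteq> {} \<and> answer_sets (epistemic_reduct P (induced_guess (elits P) \<M>)) = \<M>"
  by (simp add: CWV_def cwv_guess_iff eq_commute[of \<M>])

lemma WV_iff:
  "\<M> \<in> WV P \<longleftrightarrow> \<M> \<in> CWV P \<and>
    (\<forall>\<M>' \<in> CWV P. \<not> induced_guess (elits P) \<M> \<subset> induced_guess (elits P) \<M>')"
proof -
  have "cwv_guess P \<Phi> \<M> \<longleftrightarrow> \<M> \<in> CWV P \<and> \<Phi> = induced_guess (elits P) \<M>" for \<Phi> \<M>
    unfolding CWV_iff cwv_guess_iff by blast
  then show ?thesis
    by (auto simp: WV_def)
qed

lemma WV_equivalent_if_CWV_equivalent: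
  "CWV_equivalent P Q \<Longrightarrow> elits P = elits Q \<Longrightarrow> WV_equivalent P Q"
  by (auto simp: CWV_equivalent_def WV_equivalent_def WV_iff)

lemma CWV_equivalent_if_answer_sets_eq:
  assumes "elits P = elits Q"
    and "\<And>\<Phi>. answer_sets (epistemic_reduct P \<Phi>) = answer_sets (epistemic_reduct Q \<Phi>)"
  shows "CWV_equivalent P Q"
  using assms by (auto simp: CWV_equivalent_def CWV_iff)

lemma CWV_no_elits: "elits P = {} \<Longrightarrow> CWV P = {answer_sets (epistemic_reduct P {})} - {{}}"
  by (auto simp: CWV_iff induced_guess_def)

lemma WV_no_elits: "elits P = {} \<Longrightarrow> WV P = CWV P"
  by (auto simp: WV_iff induced_guess_def)

lemma WV_if_full_guess:
  assumes "\<M> \<in> CWV P" "induced_guess (elits P) \<M> = elits P"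
  shows "WV P = {\<M>}"
proof -
  have guess_subset: "induced_guess (elits P) \<M>' \<subseteq> elits P" for \<M>'
    by (auto simp: induced_guess_def)
  have "\<M>' = \<M>" if "\<M>' \<in> WV P" for \<M>'
  proof -
    have "\<not> induced_guess (elits P) \<M>' \<subset> elits P"
      using that assms unfolding WV_iff by metis
    then have "induced_guess (elits P) \<M>' = elits P"
      using guess_subset by blast
    then show ?thesis
      using that assms by (auto simp: WV_iff CWV_iff)
  qed
  moreover have "\<M> \<in> WV P"
    using assms guess_subset by (auto simp: WV_iff)
  ultimately show ?thesis
    by blast
qed

lemma lit_sat_Un_fresh: "lit_atom l \<notin> E \<Longrightarrow> lit_sat (E \<union> I) l \<longleftrightarrow> lit_sat I l"
  by (cases l) auto

lemma epistemic_reduct_induced_guess_Un_fresh: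
  assumes "E \<inter> occurring_atoms P = {}"
  shows "epistemic_reduct P (induced_guess L ((\<union>) E ` \<M>)) = epistemic_reduct P (induced_guess L \<M>)"
proof (rule epistemic_reduct_cong)
  fix \<xi>
  assume "lit_atom (elit_lit \<xi>) \<in> occurring_atoms P"
  then have "lit_atom (elit_lit \<xi>) \<notin> E"
    using assms by blast
  then show "\<xi> \<in> induced_guess L ((\<union>) E ` \<M>) \<longleftrightarrow> \<xi> \<in> induced_guess L \<M>"
    by (simp add: induced_guess_def lit_sat_Un_fresh)
qed

lemma CWV_add_fresh_facts:
  assumes fresh: "E \<inter> occurring_atoms P = {}" and "E \<subseteq> atoms P"
  shows "CWV (add_facts P E) = (`) ((\<union>) E) ` CWV P"
proof -
  let ?red = "\<lambda>\<M>. epistemic_reduct P (induced_guess (elits P) \<M>)"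
  have CWV_add_facts_iff: "\<N> \<in> CWV (add_facts P E) \<longleftrightarrow>
      \<N> \<noteq> {} \<and> (\<union>) E ` answer_sets (?red \<N>) = \<N>" for \<N>
    by (simp add: CWV_iff answer_sets_epistemic_reduct_add_fresh_facts[OF assms])
  have red_image: "?red ((\<union>) E ` \<M>) = ?red \<M>" for \<M>
    by (rule epistemic_reduct_induced_guess_Un_fresh[OF fresh])
  show ?thesis
  proof (intro equalityI subsetI)
    fix \<N>
    assume cwv: "\<N> \<in> CWV (add_facts P E)"
    define \<M> where "\<M> = answer_sets (?red \<N>)"
    have image: "\<N> = (\<union>) E ` \<M>"
      using cwv by (simp add: CWV_add_facts_iff \<M>_def)
    then have "answer_sets (?red \<M>) = answer_sets (?red \<N>)"
      by (simp only: red_image)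
    also have "\<dots> = \<M>"
      by (simp only: \<M>_def)
    finally have "\<M> \<in> CWV P"
      using cwv image by (simp add: CWV_iff CWV_add_facts_iff)
    with image show "\<N> \<in> (`) ((\<union>) E) ` CWV P"
      by (rule image_eqI)
  next
    fix \<N>
    assume "\<N> \<in> (`) ((\<union>) E) ` CWV P"
    then obtain \<M> where image: "\<N> = (\<union>) E ` \<M>" and "\<M> \<in> CWV P"
      by blast
    then have "\<M> \<noteq> {}" "answer_sets (?red \<M>) = \<M>"
      by (simp_all add: CWV_iff)
    then show "\<N> \<in> CWV (add_facts P E)"
      by (simp add: image CWV_add_facts_iff red_image)
  qed
qed

section \<open>Implications between the notions of equivalence\<close>

lemma CWV_equivalent_add_facts_if_restricted:
  assumes atoms_eq: "atoms P = atoms Q" and D_subset: "D \<subseteq> atoms P"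
    and occurring: "occurring_atoms P \<subseteq> V" "occurring_atoms Q \<subseteq> V"
    and restricted: "CWV_equivalent (add_facts P (D \<inter> V)) (add_facts Q (D \<inter> V))"
  shows "CWV_equivalent (add_facts P D) (add_facts Q D)"
proof -
  have CWV_split: "CWV (add_facts R D) = (`) ((\<union>) (D - V)) ` CWV (add_facts R (D \<inter> V))"
    if "occurring_atoms R \<subseteq> V" "D \<subseteq> atoms R" for R
  proof -
    have "CWV (add_facts R D) = CWV (add_facts (add_facts R (D \<inter> V)) (D - V))"
      by (simp only: add_facts_add_facts Int_Diff_Un)
    also have "\<dots> = (`) ((\<union>) (D - V)) ` CWV (add_facts R (D \<inter> V))"
      using that by (intro CWV_add_fresh_facts) (auto simp: occurring_atoms_add_facts)
    finally show ?thesis .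
  qed
  have "D \<subseteq> atoms Q"
    using D_subset atoms_eq by simp
  then show ?thesis
    using restricted CWV_split[OF occurring(1) D_subset] CWV_split[OF occurring(2)]
    by (simp only: CWV_equivalent_def)
qed

lemma uniformly_CWV_equivalent_if_strongly_equivalent:
  assumes pair: "elp_pair P Q" and strong: "strongly_equivalent P Q"
  shows "uniformly_CWV_equivalent P Q"
  unfolding uniformly_CWV_equivalent_def
proof (intro allI impI)
  fix D
  assume D_subset: "D \<subseteq> atoms P"
  define V where "V = occurring_atoms P \<union> occurring_atoms Q"
  have atoms_eq: "atoms P = atoms Q"
    using pair by (simp add: elp_pair_def)
  have "finite V"
    using pair by (simp add: V_def elp_pair_def finite_occurring_atoms)
  then have "is_elp (facts (atoms P) (D \<inter> V))"
    using D_subset by (intro is_elp_facts) auto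
  then have "CWV_equivalent (add_facts P (D \<inter> V)) (add_facts Q (D \<inter> V))"
    using strong by (simp add: strongly_equivalent_def atoms_eq)
  then have "CWV_equivalent (add_facts P D) (add_facts Q D)"
    using atoms_eq D_subset
    by (intro CWV_equivalent_add_facts_if_restricted[of P Q D V]) (simp_all add: V_def)
  then show "CWV_equivalent (add_facts P D) (elp_union Q (facts (atoms P) D))"
    by (simp add: atoms_eq)
qed

lemma uniformly_WV_equivalent_if_uniformly_CWV_equivalent:
  "elp_pair P Q \<Longrightarrow> uniformly_CWV_equivalent P Q \<Longrightarrow> uniformly_WV_equivalent P Q"
  by (simp add: uniformly_CWV_equivalent_def uniformly_WV_equivalent_def elp_pair_def
      WV_equivalent_if_CWV_equivalent)

lemma CWV_equivalent_if_uniformly_CWV_equivalent: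
  "elp_pair P Q \<Longrightarrow> uniformly_CWV_equivalent P Q \<Longrightarrow> CWV_equivalent P Q"
  by (metis add_facts_empty elp_pair_def empty_subsetI uniformly_CWV_equivalent_def)

lemma WV_equivalent_if_uniformly_WV_equivalent:
  "elp_pair P Q \<Longrightarrow> uniformly_WV_equivalent P Q \<Longrightarrow> WV_equivalent P Q"
  by (metis add_facts_empty elp_pair_def empty_subsetI uniformly_WV_equivalent_def)

lemma strictly_strongerI:
  assumes "\<And>P Q. elp_pair P Q \<Longrightarrow> S P Q \<Longrightarrow> T P Q" "elp_pair P Q" "T P Q" "\<not> S P Q"
  shows "strictly_stronger S T"
  using assms unfolding strictly_stronger_def by blast

section \<open>Separating examples\<close>

definition disjunction ::
  "'a \<Rightarrow> 'a \<Rightarrow> 'a epistemic_literal set \<Rightarrow> 'a epistemic_literal set \<Rightarrow> 'a elp" where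
  "disjunction a b E B = \<lparr>atoms = {a, b}, elits = E,
    rules = {\<lparr>head = {a, b}, body_lits = {}, body_epos = B, body_eneg = {}\<rparr>}\<rparr>"

definition choice :: "'a \<Rightarrow> 'a \<Rightarrow> 'a elp" where
  "choice a b = \<lparr>atoms = {a, b}, elits = {}, rules = {
    \<lparr>head = {a}, body_lits = {NegLit b}, body_epos = {}, body_eneg = {}\<rparr>,
    \<lparr>head = {b}, body_lits = {NegLit a}, body_epos = {}, body_eneg = {}\<rparr>}\<rparr>"

definition loop :: "'a \<Rightarrow> 'a \<Rightarrow> 'a elp" where
  "loop a b = \<lparr>atoms = {a, b}, elits = {}, rules = {
    \<lparr>head = {a}, body_lits = {PosLit b}, body_epos = {}, body_eneg = {}\<rparr>,
    \<lparr>head = {b}, body_lits = {PosLit a}, body_epos = {}, body_eneg = {}\<rparr>}\<rparr>"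

definition no_rules :: "'a \<Rightarrow> 'a elp" where
  "no_rules a = \<lparr>atoms = {a}, elits = {}, rules = {}\<rparr>"

definition constraint :: "'a \<Rightarrow> 'a elp" where
  "constraint a = \<lparr>atoms = {a}, elits = {},
    rules = {\<lparr>head = {}, body_lits = {PosLit a}, body_epos = {}, body_eneg = {}\<rparr>}\<rparr>"

lemma atoms_disjunction [simp]: "atoms (disjunction a b E B) = {a, b}"
  and elits_disjunction [simp]: "elits (disjunction a b E B) = E"
  by (simp_all add: disjunction_def)

lemma atoms_choice [simp]: "atoms (choice a b) = {a, b}"
  and elits_choice [simp]: "elits (choice a b) = {}"
  by (simp_all add: choice_def)

lemma atoms_loop [simp]: "atoms (loop a b) = {a, b}"
  and elits_loop [simp]: "elits (loop a b) = {}"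
  by (simp_all add: loop_def)

lemma atoms_no_rules [simp]: "atoms (no_rules a) = {a}"
  and elits_no_rules [simp]: "elits (no_rules a) = {}"
  by (simp_all add: no_rules_def)

lemma atoms_constraint [simp]: "atoms (constraint a) = {a}"
  and elits_constraint [simp]: "elits (constraint a) = {}"
  by (simp_all add: constraint_def)

lemma ht_model_disjunction [simp]:
  "ht_model (epistemic_reduct (disjunction a b E B) \<Phi>) X M \<longleftrightarrow>
    (\<forall>\<xi> \<in> B. \<xi> \<in> \<Phi> \<or> \<not> lit_sat M (elit_lit \<xi>)) \<longrightarrow> a \<in> X \<or> b \<in> X"
proof -
  have "ht_nsat X M (reduct_elit \<Phi> \<xi>) \<longleftrightarrow> \<xi> \<in> \<Phi> \<or> \<not> lit_sat M (elit_lit \<xi>)" for \<xi>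
    by (simp add: reduct_elit_def)
  then show ?thesis
    by (simp add: ht_model_def ht_rule_sat_def epistemic_reduct_def reduct_rule_def
        disjunction_def)
qed

lemma ht_model_choice [simp]:
  "ht_model (epistemic_reduct (choice a b) \<Phi>) X M \<longleftrightarrow> (a \<in> X \<or> b \<in> M) \<and> (b \<in> X \<or> a \<in> M)"
  by (auto simp: ht_model_def ht_rule_sat_def epistemic_reduct_def reduct_rule_def choice_def)

lemma ht_model_loop [simp]:
  "ht_model (epistemic_reduct (loop a b) \<Phi>) X M \<longleftrightarrow> (a \<in> X \<longleftrightarrow> b \<in> X)"
  by (auto simp: ht_model_def ht_rule_sat_def epistemic_reduct_def reduct_rule_def loop_def)

lemma ht_model_no_rules [simp]: "ht_model (epistemic_reduct (no_rules a) \<Phi>) X M"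
  by (simp add: ht_model_def epistemic_reduct_def no_rules_def)

lemma ht_model_constraint [simp]:
  "ht_model (epistemic_reduct (constraint a) \<Phi>) X M \<longleftrightarrow> a \<notin> X"
  by (simp add: ht_model_def ht_rule_sat_def epistemic_reduct_def reduct_rule_def constraint_def)

lemma answer_sets_iff_two_atoms:
  assumes "a \<noteq> b" "lp_atoms P = {a, b}"
  shows "M \<in> answer_sets P \<longleftrightarrow>
    M = {} \<and> ht_model P {} {} \<or>
    (\<exists>c \<in> {a, b}. M = {c} \<and> ht_model P {c} {c} \<and> \<not> ht_model P {} {c}) \<or>
    M = {a, b} \<and> ht_model P M M \<and> (\<forall>X \<in> {{}, {a}, {b}}. \<not> ht_model P X M)"
proof -
  have subset: "M \<subseteq> {a, b} \<longleftrightarrow> M = {} \<or> (\<exists>c \<in> {a, b}. M = {c}) \<or> M = {a, b}"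
    by auto
  have psubset_singleton: "X \<subset> {c} \<longleftrightarrow> X = {}" for X and c :: 'a
    by auto
  have psubset_doubleton: "X \<subset> {a, b} \<longleftrightarrow> X = {} \<or> X = {a} \<or> X = {b}" for X
    using assms(1) by auto
  show ?thesis
    unfolding answer_sets_iff_equilibrium assms(2) subset
    by (simp add: conj_disj_distribR psubset_singleton psubset_doubleton all_conj_distrib
        imp_disjL cong: conj_cong)
qed

lemma answer_sets_disjunction:
  assumes "a \<noteq> b" "B \<subseteq> \<Phi>"
  shows "answer_sets (epistemic_reduct (disjunction a b E B) \<Phi>) = {{a}, {b}}"
  using assms by (auto simp: answer_sets_iff_two_atoms[of a b])

lemma answer_sets_choice:
  assumes "a \<noteq> b"
  shows "answer_sets (epistemic_reduct (choice a b) \<Phi>) = {{a}, {b}}"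
  using assms by (auto simp: answer_sets_iff_two_atoms[of a b])

lemma answer_sets_disjunction_add_facts:
  assumes "D \<subseteq> {a, b}" "D \<noteq> {}"
  shows "answer_sets (epistemic_reduct (add_facts (disjunction a b E B) D) \<Phi>) = {D}"
  unfolding epistemic_reduct_add_facts
  by (rule answer_sets_lp_add_facts_if_redundant_rules) (use assms in auto)

lemma answer_sets_choice_add_facts:
  assumes "D \<subseteq> {a, b}" "D \<noteq> {}"
  shows "answer_sets (epistemic_reduct (add_facts (choice a b) D) \<Phi>) = {D}"
  unfolding epistemic_reduct_add_facts
  by (rule answer_sets_lp_add_facts_if_redundant_rules) (use assms in auto)

lemma uniformly_CWV_equivalent_disjunction_choice:
  assumes "a \<noteq> b"
  shows "uniformly_CWV_equivalent (disjunction a b {} {}) (choice a b)"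
proof -
  have "answer_sets (epistemic_reduct (add_facts (disjunction a b {} {}) D) \<Phi>) =
      answer_sets (epistemic_reduct (add_facts (choice a b) D) \<Phi>)" if "D \<subseteq> {a, b}" for D \<Phi>
  proof (cases "D = {}")
    case True
    then show ?thesis
      by (simp only: add_facts_empty answer_sets_disjunction[OF assms empty_subsetI]
          answer_sets_choice[OF assms])
  next
    case False
    then show ?thesis
      by (simp only: answer_sets_disjunction_add_facts[OF that False]
          answer_sets_choice_add_facts[OF that False])
  qed
  then show ?thesis
    by (simp add: uniformly_CWV_equivalent_def CWV_equivalent_if_answer_sets_eq)
qed

lemma not_strongly_equivalent_disjunction_choice:
  assumes "a \<noteq> b"
  shows "\<not> strongly_equivalent (disjunction a b {} {}) (choice a b)"
proof -
  let ?P = "elp_union (disjunction a b {} {}) (loop a b)"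
  let ?Q = "elp_union (choice a b) (loop a b)"
  have "answer_sets (epistemic_reduct ?P {}) = {{a, b}}" "answer_sets (epistemic_reduct ?Q {}) = {}"
    using assms
    by (auto simp: answer_sets_iff_two_atoms[of a b] ht_model_epistemic_reduct_elp_union)
  then have "\<not> CWV_equivalent ?P ?Q"
    by (simp add: CWV_equivalent_def CWV_no_elits)
  moreover have "is_elp (loop a b)"
    by (auto simp: is_elp_def elp_rule_over_def loop_def)
  ultimately show ?thesis
    by (auto simp: strongly_equivalent_def)
qed

lemma strong_strictly_stronger_than_uniform_CWV:
  assumes "(a :: 'a) \<noteq> b"
  shows "strictly_stronger (strongly_equivalent :: 'a elp \<Rightarrow> 'a elp \<Rightarrow> bool)
    uniformly_CWV_equivalent"
proof (rule strictly_strongerI)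
  show "elp_pair (disjunction a b {} {}) (choice a b)"
    by (auto simp: elp_pair_def is_elp_def elp_rule_over_def disjunction_def choice_def)
qed (fact uniformly_CWV_equivalent_if_strongly_equivalent
    uniformly_CWV_equivalent_disjunction_choice[OF assms]
    not_strongly_equivalent_disjunction_choice[OF assms])+

definition possible :: "'a set \<Rightarrow> 'a epistemic_literal set" where
  "possible A = (\<lambda>a. ENot (NegLit a)) ` A"

lemma WV_disjunction:
  assumes "a \<noteq> b" "B \<subseteq> possible {a, b}"
  shows "WV (disjunction a b (possible {a, b}) B) = {{{a}, {b}}}"
proof (rule WV_if_full_guess)
  show full: "induced_guess (elits (disjunction a b (possible {a, b}) B)) {{a}, {b}} =
      elits (disjunction a b (possible {a, b}) B)"
    by (auto simp: induced_guess_def possible_def)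
  show "{{a}, {b}} \<in> CWV (disjunction a b (possible {a, b}) B)"
    unfolding CWV_iff full using answer_sets_disjunction[OF assms] by simp
qed

lemma uniformly_WV_equivalent_disjunctions:
  assumes "a \<noteq> b" "B \<subseteq> possible {a, b}" "C \<subseteq> possible {a, b}"
  shows "uniformly_WV_equivalent
    (disjunction a b (possible {a, b}) B) (disjunction a b (possible {a, b}) C)"
    (is "uniformly_WV_equivalent ?P ?Q")
proof -
  have "WV_equivalent (add_facts ?P D) (add_facts ?Q D)" if "D \<subseteq> {a, b}" for D
  proof (cases "D = {}")
    case True
    then show ?thesis
      by (simp only: add_facts_empty WV_equivalent_def WV_disjunction[OF assms(1,2)]
          WV_disjunction[OF assms(1,3)])
  next
    case False
    have "CWV_equivalent (add_facts ?P D) (add_facts ?Q D)"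
      by (rule CWV_equivalent_if_answer_sets_eq)
        (simp_all only: answer_sets_disjunction_add_facts[OF that False] elits_elp_union
          elits_facts elits_disjunction)
    then show ?thesis
      by (rule WV_equivalent_if_CWV_equivalent) simp
  qed
  then show ?thesis
    by (simp add: uniformly_WV_equivalent_def)
qed

lemma not_CWV_equivalent_disjunctions:
  assumes "a \<noteq> b"
  shows "\<not> CWV_equivalent
    (disjunction a b (possible {a, b}) (possible {a, b})) (disjunction a b (possible {a, b}) {})"
    (is "\<not> CWV_equivalent ?P ?Q")
proof -
  have "induced_guess (possible {a, b}) {{}} = {}"
    by (auto simp: induced_guess_def possible_def)
  moreover have "answer_sets (epistemic_reduct ?P {}) = {{}}"
    using assms by (auto simp: answer_sets_iff_two_atoms[of a b] possible_def)
  ultimately have "{{}} \<in> CWV ?P"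
    by (simp add: CWV_iff)
  moreover have "{{}} \<notin> CWV ?Q"
    using answer_sets_disjunction[OF assms] by (simp add: CWV_iff)
  ultimately show ?thesis
    by (auto simp: CWV_equivalent_def)
qed

lemma uniform_CWV_strictly_stronger_than_uniform_WV:
  assumes "(a :: 'a) \<noteq> b"
  shows "strictly_stronger (uniformly_CWV_equivalent :: 'a elp \<Rightarrow> 'a elp \<Rightarrow> bool)
    uniformly_WV_equivalent"
proof (rule strictly_strongerI)
  let ?P = "disjunction a b (possible {a, b}) (possible {a, b})"
  let ?Q = "disjunction a b (possible {a, b}) {}"
  show pair: "elp_pair ?P ?Q"
    by (auto simp: elp_pair_def is_elp_def elp_rule_over_def disjunction_def possible_def)
  show "uniformly_WV_equivalent ?P ?Q"
    using assms by (intro uniformly_WV_equivalent_disjunctions) simp_all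
  show "\<not> uniformly_CWV_equivalent ?P ?Q"
    using not_CWV_equivalent_disjunctions[OF assms]
      CWV_equivalent_if_uniformly_CWV_equivalent[OF pair] by blast
qed (fact uniformly_WV_equivalent_if_uniformly_CWV_equivalent)

lemma elp_pair_no_rules_constraint: "elp_pair (no_rules a) (constraint a)"
  by (auto simp: elp_pair_def is_elp_def elp_rule_over_def no_rules_def constraint_def)

lemma CWV_equivalent_no_rules_constraint: "CWV_equivalent (no_rules a) (constraint a)"
  by (rule CWV_equivalent_if_answer_sets_eq) (auto simp: answer_sets_iff_equilibrium)

lemma not_CWV_equivalent_no_rules_constraint_add_fact:
  "\<not> CWV_equivalent (add_facts (no_rules a) {a}) (add_facts (constraint a) {a})"
proof -
  have "answer_sets (epistemic_reduct (add_facts (no_rules a) {a}) {}) = {{a}}"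
    unfolding epistemic_reduct_add_facts
    by (rule answer_sets_lp_add_facts_if_redundant_rules) simp_all
  moreover have "answer_sets (epistemic_reduct (add_facts (constraint a) {a}) {}) = {}"
    unfolding epistemic_reduct_add_facts by (auto simp: answer_sets_iff_equilibrium)
  ultimately show ?thesis
    by (simp add: CWV_equivalent_def CWV_no_elits)
qed

lemma uniform_CWV_strictly_stronger_than_CWV:
  "strictly_stronger (uniformly_CWV_equivalent :: 'a elp \<Rightarrow> 'a elp \<Rightarrow> bool) CWV_equivalent"
proof (rule strictly_strongerI)
  fix a :: 'a
  show "\<not> uniformly_CWV_equivalent (no_rules a) (constraint a)"
    using not_CWV_equivalent_no_rules_constraint_add_fact[of a]
    by (auto simp: uniformly_CWV_equivalent_def)
qed (fact CWV_equivalent_if_uniformly_CWV_equivalent elp_pair_no_rules_constraint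
    CWV_equivalent_no_rules_constraint)+

lemma uniform_WV_strictly_stronger_than_WV:
  "strictly_stronger (uniformly_WV_equivalent :: 'a elp \<Rightarrow> 'a elp \<Rightarrow> bool) WV_equivalent"
proof (rule strictly_strongerI)
  fix a :: 'a
  show "WV_equivalent (no_rules a) (constraint a)"
    using CWV_equivalent_no_rules_constraint by (rule WV_equivalent_if_CWV_equivalent) simp
  have "\<not> WV_equivalent (add_facts (no_rules a) {a}) (add_facts (constraint a) {a})"
    using not_CWV_equivalent_no_rules_constraint_add_fact[of a]
    by (simp add: WV_equivalent_def CWV_equivalent_def WV_no_elits)
  then show "\<not> uniformly_WV_equivalent (no_rules a) (constraint a)"
    by (auto simp: uniformly_WV_equivalent_def)
qed (fact WV_equivalent_if_uniformly_WV_equivalent elp_pair_no_rules_constraint)+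

theorem theorem3:
  assumes "infinite (UNIV :: 'a set)"
  shows "strictly_stronger (strongly_equivalent :: 'a elp \<Rightarrow> 'a elp \<Rightarrow> bool) uniformly_CWV_equivalent
    \<and> strictly_stronger (uniformly_CWV_equivalent :: 'a elp \<Rightarrow> 'a elp \<Rightarrow> bool) uniformly_WV_equivalent
    \<and> strictly_stronger (uniformly_CWV_equivalent :: 'a elp \<Rightarrow> 'a elp \<Rightarrow> bool) CWV_equivalent
    \<and> strictly_stronger (uniformly_WV_equivalent :: 'a elp \<Rightarrow> 'a elp \<Rightarrow> bool) WV_equivalent"
proof -
  obtain a b :: 'a where "a \<noteq> b"
    using ex_new_if_finite[OF assms, of "{undefined}"] by auto
  then show ?thesis
    by (intro conjI strong_strictly_stronger_than_uniform_CWV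
        uniform_CWV_strictly_stronger_than_uniform_WV
        uniform_CWV_strictly_stronger_than_CWV uniform_WV_strictly_stronger_than_WV)
qed

end
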